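(* Let $\rho:[0,+\infty)\to\mathbb{R}$ satisfy: (AS1) $\rho(0)=0$, $\rho(s)<+\infty$ for all $s<+\infty$, and $0$ is the strict minimizer of $\rho$; (AS2) $\rho$ is increasing on $[0,+\infty)$; (AS3) $\rho$ is $C^2$ on $(0,+\infty)$; (AS4) either $\rho''<0$ and $\rho''$ is strictly increasing on $(0,+\infty)$, or $\rho''\equiv0$ on $(0,+\infty)$. Let $\tau>0$, $\beta>0$, $t\ge0$, $\chi_1(s)=\rho(s)+\frac{\beta}{2}(s-t)^2$ for $s\ge0$, and $$s_L=\inf\{s\in(0,+\infty):\rho''(s)>-\beta\}.$$ Then: (1) If $s_L>0$ and $\chi_1'(s_L)\ge0$ (respectively, $s_L=0$ and $\chi_1'(0^+)\ge0$), then $s_1^*=0$ is the unique global minimizer of $\min_{0\le s\le\tau}\chi_1(s)$. (2) If $s_L>0$ and $\chi_1'(s_L)<0$ (respectively, $s_L=0$ and $\chi_1'(0^+)<0$), then the equation $\chi_1'(s)=0$ has a unique root $\bar s$ on $[s_L,t]$. Setting $\mathcal{X}=\{0,\min(\bar s,\tau)\}$, the global minimizer of $\min_{0\le s\le\tau}\chi_1(s)$ is given by $s_1^*=\arg\min_{s\in\mathcal{X}}\chi_1(s)$.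
   Context: "Increasing" in (AS2) is meant in the non-strict sense. For $s>0$, $\chi_1'(s)=\rho'(s)+\beta(s-t)$, and $\chi_1'(0^+)=\lim_{s\to0^+}\chi_1'(s)$; when $s_L=0$, the derivative at the endpoint $0$ is understood as $\chi_1'(0^+)$. *)

theory Defs
  imports "HOL-Analysis.Analysis"
begin

text \<open>
  A function on the half-line \<open>[0, \<infinity>)\<close> is represented by a total function
  \<^typ>\<open>real \<Rightarrow> real\<close>. Its values at negative arguments are irrelevant: every derivative
  below is taken at a point of the open half-line, or as a limit of such derivatives.
  Finiteness of \<open>\<rho>(s)\<close> is implied by the codomain \<^typ>\<open>real\<close>.
\<close>

definition AS1 :: "(real \<Rightarrow> real) \<Rightarrow> bool" where
  "AS1 \<rho> \<longleftrightarrow> \<rho> 0 = 0 \<and> (\<forall>s>0. \<rho> 0 < \<rho> s)"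

definition AS2 :: "(real \<Rightarrow> real) \<Rightarrow> bool" where
  "AS2 \<rho> \<longleftrightarrow> mono_on {0..} \<rho>"

definition AS3 :: "(real \<Rightarrow> real) \<Rightarrow> bool" where
  "AS3 \<rho> \<longleftrightarrow> \<rho> differentiable_on {0<..} \<and> deriv \<rho> differentiable_on {0<..} \<and>
     continuous_on {0<..} (deriv (deriv \<rho>))"

definition AS4 :: "(real \<Rightarrow> real) \<Rightarrow> bool" where
  "AS4 \<rho> \<longleftrightarrow>
     ((\<forall>s>0. deriv (deriv \<rho>) s < 0) \<and> strict_mono_on {0<..} (deriv (deriv \<rho>))) \<or>
     (\<forall>s>0. deriv (deriv \<rho>) s = 0)"

definition chi1 :: "(real \<Rightarrow> real) \<Rightarrow> real \<Rightarrow> real \<Rightarrow> real \<Rightarrow> real" where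
  "chi1 \<rho> \<beta> t s = \<rho> s + \<beta> / 2 * (s - t)\<^sup>2"

text \<open>
  The infimum is over a set bounded below by 0. Under the assumptions above and \<open>\<beta> > 0\<close> the set
  is nonempty: otherwise \<open>\<rho>'' \<le> -\<beta>\<close> throughout, so \<open>\<rho>'\<close> would eventually be negative,
  against monotonicity.
\<close>
definition s_L :: "(real \<Rightarrow> real) \<Rightarrow> real \<Rightarrow> real" where
  "s_L \<rho> \<beta> = Inf {s. 0 < s \<and> deriv (deriv \<rho>) s > - \<beta>}"

text \<open>
  The limit from the right may be infinite in general (e.g. for \<open>\<rho>(s) = sqrt s\<close>), in which case
  the value of \<^const>\<open>Lim\<close> is meaningless. It is used only when \<open>s_L = 0\<close>; then \<open>\<rho>'' > -\<beta>\<close> on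
  the whole open half-line, so \<open>\<rho>'\<close> is monotone and bounded near 0 and the limit exists.
\<close>
definition dchi1_0 :: "(real \<Rightarrow> real) \<Rightarrow> real \<Rightarrow> real \<Rightarrow> real" where
  "dchi1_0 \<rho> \<beta> t = Lim (at_right 0) (deriv (chi1 \<rho> \<beta> t))"

definition dchi1 :: "(real \<Rightarrow> real) \<Rightarrow> real \<Rightarrow> real \<Rightarrow> real \<Rightarrow> real" where
  "dchi1 \<rho> \<beta> t s = (if s = 0 then dchi1_0 \<rho> \<beta> t else deriv (chi1 \<rho> \<beta> t) s)"

definition minimizers_on :: "('a \<Rightarrow> real) \<Rightarrow> 'a set \<Rightarrow> 'a set" where
  "minimizers_on f A = {x. is_arg_min f (\<lambda>y. y \<in> A) x}"

end

theory Submission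
  imports Defs
begin

text \<open>
  The derivative \<open>g\<close> of \<open>chi1\<close> is strictly decreasing on \<open>(0, s_L]\<close> and strictly increasing on
  \<open>[s_L, \<infinity>)\<close>. If \<open>g(s_L) \<ge> 0\<close>, then \<open>chi1\<close> is strictly increasing on \<open>(0, \<infinity>)\<close>; the function may
  jump at 0, but only upwards, so 0 is the unique minimizer. If \<open>g(s_L) < 0\<close>, then \<open>g\<close> has a
  unique zero \<open>r\<close> to the right of \<open>s_L\<close>, which lies in \<open>[s_L, t]\<close> since \<open>\<rho>' \<ge> 0\<close>. A point
  \<open>0 < s < r\<close> is beaten by 0 if \<open>g(s) \<ge> 0\<close>, because then \<open>g > 0\<close> on \<open>(0, s)\<close>, and by every later
  point of \<open>(s, r]\<close> if \<open>g(s) < 0\<close>, because then \<open>g < 0\<close> on \<open>(s, r)\<close>. Points beyond \<open>r\<close> are beaten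
  by \<open>r\<close>.
\<close>

text \<open>A point outside \<open>S\<close> is strictly beaten from inside \<open>S\<close>, so it
  is no minimizer over \<open>A\<close>. It cannot undercut a minimizer over \<open>S\<close>
  either, since some point of \<open>S\<close> would then lie lower still. Existence of minimizers
  is not presupposed.\<close>

lemma minimizers_on_eqI:
  fixes f :: "'a \<Rightarrow> real"
  assumes "S \<subseteq> A" and "\<And>x. x \<in> A - S \<Longrightarrow> \<exists>y\<in>S. f y < f x"
  shows "minimizers_on f A = minimizers_on f S"
proof -
  have "is_arg_min f (\<lambda>y. y \<in> A) x \<longleftrightarrow> is_arg_min f (\<lambda>y. y \<in> S) x" for x
    using assms unfolding is_arg_min_def
    by (smt (verit, ccfv_threshold) DiffI in_mono)
  thus ?thesis unfolding minimizers_on_def by auto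
qed

lemma minimizers_on_singleton: "minimizers_on f {x} = {x}"
  unfolding minimizers_on_def is_arg_min_def by auto

locale penalized =
  fixes \<rho> :: "real \<Rightarrow> real" and \<beta> t :: real
  assumes AS1: "AS1 \<rho>" and AS2: "AS2 \<rho>" and AS3: "AS3 \<rho>" and AS4: "AS4 \<rho>"
    and beta_pos: "\<beta> > 0"
begin

text \<open>This represents the derivative of \<open>chi1\<close> only for positive
  \<open>s\<close>; \<open>deriv \<rho> 0\<close> would depend on the irrelevant values at negative
  arguments, so \<open>dchi1\<close> serves at the endpoint.\<close>

abbreviation g where "g s \<equiv> deriv \<rho> s + \<beta> * (s - t)"
abbreviation c where "c \<equiv> s_L \<rho> \<beta>"

section \<open>First and second derivatives\<close>

lemma rho_deriv: "s > 0 \<Longrightarrow> (\<rho> has_real_derivative deriv \<rho> s) (at s)"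
  using AS3 differentiable_on_eq_differentiable_at[of "{0<..}" \<rho>]
  unfolding AS3_def by (auto simp: DERIV_deriv_iff_real_differentiable)

lemma rho_deriv2: "s > 0 \<Longrightarrow> (deriv \<rho> has_real_derivative deriv (deriv \<rho>) s) (at s)"
  using AS3 differentiable_on_eq_differentiable_at[of "{0<..}" "deriv \<rho>"]
  unfolding AS3_def by (auto simp: DERIV_deriv_iff_real_differentiable)

lemma deriv_rho_nonneg:
  assumes "s > 0" shows "deriv \<rho> s \<ge> 0"
proof (rule ccontr)
  assume "\<not> deriv \<rho> s \<ge> 0"
  then obtain d where d: "d > 0" "\<And>h. h > 0 \<Longrightarrow> h < d \<Longrightarrow> \<rho> (s + h) < \<rho> s"
    using DERIV_neg_dec_right[OF rho_deriv[OF assms]] by auto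
  have "\<rho> s \<le> \<rho> (s + d / 2)"
    using AS2 assms d(1) unfolding AS2_def by (intro mono_onD[of "{0..}" \<rho>]) auto
  thus False using d(2)[of "d / 2"] d(1) by simp
qed

lemma chi1_deriv: "s > 0 \<Longrightarrow> (chi1 \<rho> \<beta> t has_real_derivative g s) (at s)"
  unfolding chi1_def[abs_def]
  by (auto intro!: derivative_eq_intros rho_deriv simp: field_simps)

lemma deriv_chi1: "s > 0 \<Longrightarrow> deriv (chi1 \<rho> \<beta> t) s = g s"
  using chi1_deriv DERIV_imp_deriv by blast

lemma g_deriv: "s > 0 \<Longrightarrow> (g has_real_derivative deriv (deriv \<rho>) s + \<beta>) (at s)"
  by (auto intro!: derivative_eq_intros rho_deriv2)

lemma g_continuous: "S \<subseteq> {0<..} \<Longrightarrow> continuous_on S g"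
  using g_deriv DERIV_isCont by (intro continuous_at_imp_continuous_on) blast

section \<open>The threshold s_L\<close>

lemma s_L_set_nonempty: "{s. 0 < s \<and> deriv (deriv \<rho>) s > - \<beta>} \<noteq> {}"
proof
  assume *: "{s. 0 < s \<and> deriv (deriv \<rho>) s > - \<beta>} = {}"
  \<comment> \<open>If \<open>\<rho>'' \<le> -\<beta>\<close> everywhere, \<open>g\<close> does not
    increase. The point \<open>b\<close> is so far to the right that \<open>g b \<le> g 1\<close>
    would force \<open>deriv \<rho> b \<le> -\<beta>\<close>.\<close>
  define b where "b = 2 + deriv \<rho> 1 / \<beta>"
  have b: "b > 1" using deriv_rho_nonneg[of 1] beta_pos unfolding b_def
    by (smt (verit) divide_nonneg_pos)
  have "\<exists>y. (g has_real_derivative y) (at x) \<and> y \<le> 0" if "1 \<le> x" for x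
  proof -
    have "x \<notin> {s. 0 < s \<and> deriv (deriv \<rho>) s > - \<beta>}" unfolding * by simp
    thus ?thesis using g_deriv[of x] that by (intro exI[of _ "deriv (deriv \<rho>) x + \<beta>"]) auto
  qed
  hence "g b \<le> g 1"
    using b by (intro DERIV_nonpos_imp_nonincreasing[where f = g]) auto
  moreover have "\<beta> * (b - 1) = \<beta> + deriv \<rho> 1"
    using beta_pos unfolding b_def by (simp add: field_simps)
  ultimately have "deriv \<rho> b \<le> - \<beta>" by (simp add: algebra_simps)
  thus False using deriv_rho_nonneg[of b] b beta_pos by simp
qed

lemma s_L_nonneg: "c \<ge> 0"
  unfolding s_L_def using s_L_set_nonempty by (intro cInf_greatest) auto

lemma deriv2_mono: "0 < s \<Longrightarrow> s \<le> s' \<Longrightarrow> deriv (deriv \<rho>) s \<le> deriv (deriv \<rho>) s'"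
  using AS4 unfolding AS4_def strict_mono_on_def
  by (cases "s = s'") (auto simp: less_le)

lemma deriv2_right:
  assumes "s > c" shows "deriv (deriv \<rho>) s > - \<beta>"
proof -
  obtain u where "0 < u" "deriv (deriv \<rho>) u > - \<beta>" "u < s"
    using assms s_L_set_nonempty unfolding s_L_def
    by (subst (asm) cInf_less_iff) (auto intro: bdd_belowI[of _ 0])
  thus ?thesis using deriv2_mono[of u s] by simp
qed

lemma deriv2_left_le:
  assumes "0 < s" "s < c" shows "deriv (deriv \<rho>) s \<le> - \<beta>"
proof (rule ccontr)
  assume "\<not> ?thesis"
  hence "c \<le> s" unfolding s_L_def using assms
    by (intro cInf_lower) (auto intro: bdd_belowI[of _ 0])
  thus False using assms by simp
qed

lemma deriv2_left:
  assumes "0 < s" "s < c" shows "deriv (deriv \<rho>) s < - \<beta>"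
proof -
  obtain u where u: "s < u" "u < c" using assms dense by blast
  have "deriv (deriv \<rho>) u \<le> - \<beta>" using deriv2_left_le u assms by simp
  \<comment> \<open>The alternative \<open>\<rho>'' = 0\<close> of \<open>AS4\<close> is excluded,
    as \<open>\<rho>''\<close> is negative at \<open>u\<close>; hence \<open>\<rho>''\<close> is
    strictly increasing.\<close>
  moreover from this have "deriv (deriv \<rho>) s < deriv (deriv \<rho>) u"
    using AS4 beta_pos u assms unfolding AS4_def strict_mono_on_def by fastforce
  ultimately show ?thesis by simp
qed

section \<open>Monotonicity of g and chi1\<close>

lemma g_increasing:
  assumes "0 < a" "c \<le> a" "a < b" shows "g a < g b"
proof (rule DERIV_pos_imp_increasing_open[where f = g])
  show "continuous_on {a..b} g" using assms by (intro g_continuous) auto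
  show "\<exists>y. (g has_real_derivative y) (at x) \<and> y > 0" if "a < x" "x < b" for x
    using assms that g_deriv[of x] deriv2_right[of x]
    by (intro exI[of _ "deriv (deriv \<rho>) x + \<beta>"]) auto
qed (use assms in simp)

lemma g_decreasing:
  assumes "0 < a" "a < b" "b \<le> c" shows "g b < g a"
proof (rule DERIV_neg_imp_decreasing_open[where f = g])
  show "continuous_on {a..b} g" using assms by (intro g_continuous) auto
  show "\<exists>y. (g has_real_derivative y) (at x) \<and> y < 0" if "a < x" "x < b" for x
    using assms that g_deriv[of x] deriv2_left[of x]
    by (intro exI[of _ "deriv (deriv \<rho>) x + \<beta>"]) auto
qed (use assms in simp)

lemma chi1_continuous: "S \<subseteq> {0<..} \<Longrightarrow> continuous_on S (chi1 \<rho> \<beta> t)"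
  using chi1_deriv DERIV_isCont by (intro continuous_at_imp_continuous_on) blast

lemma chi1_increasing:
  assumes "0 < a" "a < b" "\<And>x. a < x \<Longrightarrow> x < b \<Longrightarrow> g x > 0"
  shows "chi1 \<rho> \<beta> t a < chi1 \<rho> \<beta> t b"
proof (rule DERIV_pos_imp_increasing_open[OF assms(2)])
  show "continuous_on {a..b} (chi1 \<rho> \<beta> t)" using assms by (intro chi1_continuous) auto
  show "\<exists>y. (chi1 \<rho> \<beta> t has_real_derivative y) (at x) \<and> y > 0" if "a < x" "x < b" for x
    using assms that chi1_deriv[of x] by (intro exI[of _ "g x"]) auto
qed

lemma chi1_decreasing:
  assumes "0 < a" "a < b" "\<And>x. a < x \<Longrightarrow> x < b \<Longrightarrow> g x < 0"
  shows "chi1 \<rho> \<beta> t b < chi1 \<rho> \<beta> t a"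
proof (rule DERIV_neg_imp_decreasing_open[OF assms(2)])
  show "continuous_on {a..b} (chi1 \<rho> \<beta> t)" using assms by (intro chi1_continuous) auto
  show "\<exists>y. (chi1 \<rho> \<beta> t has_real_derivative y) (at x) \<and> y < 0" if "a < x" "x < b" for x
    using assms that chi1_deriv[of x] by (intro exI[of _ "g x"]) auto
qed

lemma chi1_0_less:
  assumes s: "s > 0" and pos: "\<And>x. 0 < x \<Longrightarrow> x < s \<Longrightarrow> g x > 0"
  shows "chi1 \<rho> \<beta> t 0 < chi1 \<rho> \<beta> t s"
proof -
  \<comment> \<open>The limit at 0 yields only a weak inequality; stopping at the midpoint leaves
    \<open>(s / 2, s)\<close> to supply strictness.\<close>
  have "chi1 \<rho> \<beta> t 0 \<le> chi1 \<rho> \<beta> t (s / 2)"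
  proof (rule tendsto_upperbound)
    \<comment> \<open>\<open>\<rho>\<close> may jump upwards at 0, so \<open>chi1\<close> itself need not tend to its value at 0.\<close>
    show "((\<lambda>x. \<beta> / 2 * (x - t)\<^sup>2) \<longlongrightarrow> chi1 \<rho> \<beta> t 0) (at_right 0)"
      using AS1 unfolding AS1_def chi1_def by (auto intro!: tendsto_eq_intros)
    show "\<forall>\<^sub>F x in at_right 0. \<beta> / 2 * (x - t)\<^sup>2 \<le> chi1 \<rho> \<beta> t (s / 2)"
    proof (rule eventually_at_rightI)
      show "\<beta> / 2 * (x - t)\<^sup>2 \<le> chi1 \<rho> \<beta> t (s / 2)" if "x \<in> {0<..<s / 2}" for x
      proof -
        have "\<beta> / 2 * (x - t)\<^sup>2 \<le> chi1 \<rho> \<beta> t x"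
          using AS1 that unfolding AS1_def chi1_def by fastforce
        also have "\<dots> < chi1 \<rho> \<beta> t (s / 2)"
          using that pos by (intro chi1_increasing) auto
        finally show ?thesis by simp
      qed
    qed (use s in simp)
  qed simp
  also have "\<dots> < chi1 \<rho> \<beta> t s" using s pos by (intro chi1_increasing) auto
  finally show ?thesis .
qed

section \<open>The derivative at the endpoint 0\<close>

lemma dchi1_0_tendsto:
  assumes "c = 0"
  shows "(g \<longlongrightarrow> dchi1_0 \<rho> \<beta> t) (at_right 0)"
proof -
  have mono: "g x \<le> g y" if "0 < x" "x \<le> y" for x y
    using g_increasing[of x y] assms that by (cases "x = y") auto
  have bdd: "bdd_below (g ` {0<..})"
    using deriv_rho_nonneg beta_pos
    by (intro bdd_belowI2[of _ "- \<beta> * t"]) (auto simp: algebra_simps)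
  \<comment> \<open>Increasing and bounded below by \<open>- \<beta> * t\<close>, \<open>g\<close>
    converges to its infimum, so \<open>Lim\<close> in \<open>dchi1_0\<close> denotes a genuine
    limit.\<close>
  have lim: "(g \<longlongrightarrow> Inf (g ` {0<..})) (at_right 0)"
  proof (rule order_tendstoI)
    fix a assume "a < Inf (g ` {0<..})"
    hence "a < g x" if "x > 0" for x
      using cInf_lower[of "g x" "g ` {0<..}"] bdd that by fastforce
    thus "\<forall>\<^sub>F x in at_right 0. a < g x" by (intro eventually_at_rightI[of 0 1]) auto
  next
    fix a assume "Inf (g ` {0<..}) < a"
    then obtain u where u: "u > 0" "g u < a"
      using cInf_less_iff[of "g ` {0<..}" a] bdd by auto
    have "g x < a" if "0 < x" "x < u" for x using mono[of x u] that u by simp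
    thus "\<forall>\<^sub>F x in at_right 0. g x < a"
      using u by (intro eventually_at_rightI[of 0 u]) auto
  qed
  have "\<forall>\<^sub>F x in at_right 0. g x = deriv (chi1 \<rho> \<beta> t) x"
    by (intro eventually_at_rightI[of 0 1]) (auto simp: deriv_chi1)
  from Lim_transform_eventually[OF lim this]
  have "dchi1_0 \<rho> \<beta> t = Inf (g ` {0<..})"
    unfolding dchi1_0_def by (intro tendsto_Lim) auto
  thus ?thesis using lim by simp
qed

lemma dchi1_0_less:
  assumes "c = 0" "s > 0" shows "dchi1_0 \<rho> \<beta> t < g s"
proof -
  have "dchi1_0 \<rho> \<beta> t \<le> g (s / 2)"
  proof (rule tendsto_upperbound[OF dchi1_0_tendsto[OF assms(1)]])
    show "\<forall>\<^sub>F x in at_right 0. g x \<le> g (s / 2)"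
      using assms g_increasing
      by (intro eventually_at_rightI[of 0 "s / 2"]) (force intro: less_imp_le)+
  qed simp
  also have "\<dots> < g s" using assms by (intro g_increasing) auto
  finally show ?thesis .
qed

lemma dchi1_eq_g: "s > 0 \<Longrightarrow> dchi1 \<rho> \<beta> t s = g s"
  unfolding dchi1_def by (simp add: deriv_chi1)

text \<open>Extending \<open>g\<close> to 0 by its right limit lets the cases \<open>c = 0\<close>
  and \<open>c > 0\<close> be treated together.\<close>

lemma dchi1_increasing:
  assumes "c \<le> a" "a < b" shows "dchi1 \<rho> \<beta> t a < dchi1 \<rho> \<beta> t b"
proof (cases "a = 0")
  case True
  thus ?thesis using assms s_L_nonneg dchi1_0_less[of b] dchi1_eq_g[of b] by (simp add: dchi1_def)
next
  case False
  thus ?thesis using assms s_L_nonneg g_increasing dchi1_eq_g by simp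
qed

lemma g_pos:
  assumes "dchi1 \<rho> \<beta> t c \<ge> 0" "s > 0" "s \<noteq> c" shows "g s > 0"
proof (cases "s < c")
  case True
  thus ?thesis using g_decreasing[of s c] assms dchi1_eq_g[of c] by simp
next
  case False
  thus ?thesis using dchi1_increasing[of c s] assms dchi1_eq_g[of s] by simp
qed

section \<open>Nonnegative derivative at s_L\<close>

lemma minimizers_nonneg_case:
  assumes "dchi1 \<rho> \<beta> t c \<ge> 0" "\<tau> > 0"
  shows "minimizers_on (chi1 \<rho> \<beta> t) {0..\<tau>} = {0}"
proof -
  have less: "chi1 \<rho> \<beta> t 0 < chi1 \<rho> \<beta> t s" if s: "s > 0" for s
  proof (cases "s \<le> c")
    case True
    thus ?thesis using g_pos assms s by (intro chi1_0_less) auto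
  next
    case False
    show ?thesis
    proof (cases "c = 0")
      case True
      thus ?thesis using g_pos assms s by (intro chi1_0_less) auto
    next
      case c: False
      \<comment> \<open>\<open>g\<close> may vanish at \<open>c\<close>, so the interval is split there.\<close>
      have "chi1 \<rho> \<beta> t 0 < chi1 \<rho> \<beta> t c"
        using g_pos assms c s_L_nonneg by (intro chi1_0_less) auto
      also have "\<dots> < chi1 \<rho> \<beta> t s"
        using g_pos assms c s_L_nonneg False by (intro chi1_increasing) auto
      finally show ?thesis .
    qed
  qed
  have "minimizers_on (chi1 \<rho> \<beta> t) {0..\<tau>} = minimizers_on (chi1 \<rho> \<beta> t) {0}"
    using less assms by (intro minimizers_on_eqI) auto
  thus ?thesis by (simp add: minimizers_on_singleton)
qed

section \<open>Negative derivative at s_L\<close>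

text \<open>Supplies a left end for the intermediate value theorem inside the open half-line, where
  \<open>g\<close> is continuous, even if \<open>c = 0\<close> and the negative value is only a
  limit.\<close>

lemma exists_g_neg:
  assumes "dchi1 \<rho> \<beta> t c < 0"
  obtains a where "a > 0" "c \<le> a" "g a < 0"
proof (cases "c = 0")
  case True
  hence "\<forall>\<^sub>F x in at_right 0. g x < 0"
    using order_tendstoD(2)[OF dchi1_0_tendsto, of 0] assms by (simp add: dchi1_def)
  then obtain b where b: "b > 0" "\<And>y. y > 0 \<Longrightarrow> y < b \<Longrightarrow> g y < 0"
    unfolding eventually_at_right_field by auto
  thus ?thesis using that[of "b / 2"] True by simp
next
  case False
  thus ?thesis using that[of c] assms s_L_nonneg dchi1_eq_g by simp
qed

lemma ex1_root:
  assumes neg: "dchi1 \<rho> \<beta> t c < 0"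
  shows "\<exists>!r. r \<in> {c..t} \<and> dchi1 \<rho> \<beta> t r = 0"
proof -
  obtain a where a: "a > 0" "c \<le> a" "g a < 0" using exists_g_neg[OF neg] .
  have "\<beta> * (a - t) < 0" using a deriv_rho_nonneg[of a] by simp
  hence t: "a < t" using beta_pos by (simp add: mult_less_0_iff)
  \<comment> \<open>At \<open>t\<close> the penalty term vanishes and \<open>g t\<close> is
    \<open>deriv \<rho> t\<close>.\<close>
  have "g t \<ge> 0" using deriv_rho_nonneg[of t] t a by simp
  then obtain r where r: "a \<le> r" "r \<le> t" "g r = 0"
    using IVT'[of g a 0 t] a t g_continuous[of "{a..t}"] by fastforce
  show ?thesis
  proof (rule ex1I[of _ r])
    show "r \<in> {c..t} \<and> dchi1 \<rho> \<beta> t r = 0" using r a dchi1_eq_g by simp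
  next
    fix r' assume r': "r' \<in> {c..t} \<and> dchi1 \<rho> \<beta> t r' = 0"
    show "r' = r"
      using dchi1_increasing[of r r'] dchi1_increasing[of r' r] r r' a dchi1_eq_g[of r]
      by (cases r' r rule: linorder_cases) auto
  qed
qed

lemma minimizers_neg_case:
  assumes neg: "dchi1 \<rho> \<beta> t c < 0" and "\<tau> > 0"
    and r: "r \<ge> c" "dchi1 \<rho> \<beta> t r = 0"
  shows "minimizers_on (chi1 \<rho> \<beta> t) {0..\<tau>} = minimizers_on (chi1 \<rho> \<beta> t) {0, min r \<tau>}"
proof -
  have rc: "r > c" using neg r by (cases "r = c") auto
  hence r0: "r > 0" using s_L_nonneg by simp
  have gr: "g r = 0" using r r0 dchi1_eq_g by simp
  have right_neg: "g x < 0" if "0 < x" "c \<le> x" "x < r" for x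
    using g_increasing[of x r] that gr by simp
  show ?thesis
  proof (rule minimizers_on_eqI)
    show "{0, min r \<tau>} \<subseteq> {0..\<tau>}" using \<open>\<tau> > 0\<close> r0 by auto
  next
    fix s assume s: "s \<in> {0..\<tau>} - {0, min r \<tau>}"
    hence s0: "s > 0" by auto
    consider "s > r" | "s < min r \<tau>" "g s \<ge> 0" | "s < min r \<tau>" "g s < 0"
      using s by fastforce
    thus "\<exists>y\<in>{0, min r \<tau>}. chi1 \<rho> \<beta> t y < chi1 \<rho> \<beta> t s"
    proof cases
      case 1
      have "chi1 \<rho> \<beta> t r < chi1 \<rho> \<beta> t s"
        using 1 r0 rc gr g_increasing[of r] by (intro chi1_increasing) auto
      \<comment> \<open>Here \<open>r < s \<le> \<tau>\<close>, so the candidate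
        \<open>min r \<tau>\<close> is \<open>r\<close> itself.\<close>
      thus ?thesis using 1 s by (auto simp: min_def)
    next
      case 2
      \<comment> \<open>On \<open>[c, r)\<close> the function \<open>g\<close> is negative, so a
        nonnegative value before \<open>r\<close> occurs only to the left of
        \<open>c\<close>.\<close>
      hence "s < c" using right_neg[of s] s0 by fastforce
      hence "g x > 0" if "0 < x" "x < s" for x using g_decreasing[of x s] that 2 by simp
      thus ?thesis using chi1_0_less[OF s0] by auto
    next
      case 3
      \<comment> \<open>Negativity at \<open>s\<close> persists up to \<open>c\<close> because
        \<open>g\<close> decreases there, and beyond \<open>c\<close> it holds until the
        root.\<close>
      have "g x < 0" if x: "s < x" "x < r" for x
      proof (cases "x \<le> c")
        case True
        thus ?thesis using g_decreasing[of s x] x s0 3 by simp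
      next
        case False
        thus ?thesis using right_neg x s0 by simp
      qed
      hence "chi1 \<rho> \<beta> t (min r \<tau>) < chi1 \<rho> \<beta> t s"
        using 3 s0 by (intro chi1_decreasing) auto
      thus ?thesis by auto
    qed
  qed
qed

end

theorem proposition7p5:
  fixes \<rho> :: "real \<Rightarrow> real" and \<tau> \<beta> t :: real
  assumes "AS1 \<rho>" and "AS2 \<rho>" and "AS3 \<rho>" and "AS4 \<rho>"
    and "\<tau> > 0" and "\<beta> > 0" and "t \<ge> 0"
  shows "((s_L \<rho> \<beta> > 0 \<and> dchi1 \<rho> \<beta> t (s_L \<rho> \<beta>) \<ge> 0) \<or> (s_L \<rho> \<beta> = 0 \<and> dchi1_0 \<rho> \<beta> t \<ge> 0)
          \<longrightarrow> minimizers_on (chi1 \<rho> \<beta> t) {0..\<tau>} = {0})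
       \<and> ((s_L \<rho> \<beta> > 0 \<and> dchi1 \<rho> \<beta> t (s_L \<rho> \<beta>) < 0) \<or> (s_L \<rho> \<beta> = 0 \<and> dchi1_0 \<rho> \<beta> t < 0)
          \<longrightarrow> (\<exists>!r. r \<in> {s_L \<rho> \<beta>..t} \<and> dchi1 \<rho> \<beta> t r = 0)
            \<and> (\<forall>r. r \<in> {s_L \<rho> \<beta>..t} \<and> dchi1 \<rho> \<beta> t r = 0 \<longrightarrow>
                 minimizers_on (chi1 \<rho> \<beta> t) {0..\<tau>}
                   = minimizers_on (chi1 \<rho> \<beta> t) {0, min r \<tau>}))"
proof -
  interpret penalized \<rho> \<beta> t using assms by unfold_locales
  have c0: "dchi1_0 \<rho> \<beta> t = dchi1 \<rho> \<beta> t c" if "c = 0" using that by (simp add: dchi1_def)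
  show ?thesis
  proof (rule conjI; rule impI)
    assume "(c > 0 \<and> dchi1 \<rho> \<beta> t c \<ge> 0) \<or> (c = 0 \<and> dchi1_0 \<rho> \<beta> t \<ge> 0)"
    hence "dchi1 \<rho> \<beta> t c \<ge> 0" using c0 by auto
    thus "minimizers_on (chi1 \<rho> \<beta> t) {0..\<tau>} = {0}"
      using \<open>\<tau> > 0\<close> by (rule minimizers_nonneg_case)
  next
    assume "(c > 0 \<and> dchi1 \<rho> \<beta> t c < 0) \<or> (c = 0 \<and> dchi1_0 \<rho> \<beta> t < 0)"
    hence neg: "dchi1 \<rho> \<beta> t c < 0" using c0 by auto
    show "(\<exists>!r. r \<in> {c..t} \<and> dchi1 \<rho> \<beta> t r = 0)
        \<and> (\<forall>r. r \<in> {c..t} \<and> dchi1 \<rho> \<beta> t r = 0 \<longrightarrow>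
             minimizers_on (chi1 \<rho> \<beta> t) {0..\<tau>} = minimizers_on (chi1 \<rho> \<beta> t) {0, min r \<tau>})"
      using ex1_root[OF neg] minimizers_neg_case[OF neg \<open>\<tau> > 0\<close>]
      by (simp only: atLeastAtMost_iff) blast
  qed
qed

end
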